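(* Let $X$ be a real linear space, $(Y,N)$ a fuzzy Banach space and $(Z,N')$ a fuzzy normed space. Let $\varphi_3: X\times X\to Z$ be a function such that for some real $\alpha$ with $0<\alpha<2$, $$N'\left(\varphi_3\left(2\cdot\tfrac{x}{2},2y\right),a\right)\ \ge\ N'\left(\alpha\,\varphi_3\left(\tfrac{x}{2},y\right),a\right)$$ for all $x\in X$, all $y\in\{x,\tfrac{x}{2},\tfrac{3x}{2},2x\}$ and all $a>0$, and such that $$\lim_{n\to\infty}N'\left(\varphi_3(2^nx,2^ny),2^na\right)=1$$ for all $x,y\in X$ and all $a>0$. Let $f:X\to Y$ be an odd function satisfying $$N\big(f(2x+y)+f(2x-y)-f(x+y)-f(x-y)-2f(2x)+2f(x),\,a\big)\ \ge\ N'(\varphi_3(x,y),a)$$ for all $a>0$ and all $x,y\in X$. Then there exists a unique additive mapping $A:X\to Y$ such that $$N(A(x)-f(x),a)\ \ge\ N''_3\left(x,\tfrac{a(2-\alpha)}{4}\right)$$ for all $x\in X$ and all $a>0$, where $$N''_3(x,a):=\min\Big\{N'\big(\varphi_3(x,x),a\big),\,N'\big(\varphi_3(\tfrac{x}{2},\tfrac{x}{2}),a\big),\,N'\big(\varphi_3(\tfrac{x}{2},2x),a\big),\,N'\big(\varphi_3(\tfrac{x}{2},\tfrac{3x}{2}),a\big)\Big\}.$$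
   Context: Let $V$ be a real linear space. A function $N:V\times\mathbb{R}\to[0,1]$ is a fuzzy norm on $V$ if for all $x,y\in V$ and $a,b\in\mathbb{R}$: (N1) $N(x,a)=0$ for $a\le 0$; (N2) $x=0$ if and only if $N(x,a)=1$ for all $a>0$; (N3) $N(ax,b)=N(x,\frac{b}{|a|})$ if $a\ne 0$; (N4) $N(x+y,a+b)\ge\min\{N(x,a),N(y,b)\}$; (N5) $N(x,\cdot)$ is a non-decreasing function on $\mathbb{R}$ and $\lim_{a\to\infty}N(x,a)=1$; (N6) for $x\ne 0$, $N(x,\cdot)$ is upper semicontinuous on $\mathbb{R}$. The pair $(V,N)$ is then called a fuzzy normed (linear) space. A sequence $(x_n)$ in $V$ is convergent if there exists $x\in V$ with $\lim_{n\to\infty}N(x_n-x,a)=1$ for all $a>0$. It is Cauchy if for each $\epsilon>0$ and each $a>0$ there exists $n_0$ such that $N(x_{n+p}-x_n,a)>1-\epsilon$ for all $n\ge n_0$ and all $p>0$ (integers). A fuzzy Banach space is a fuzzy normed space in which every Cauchy sequence is convergent. A mapping $A:X\to Y$ is additive if $A(x+y)=A(x)+A(y)$ for all $x,y\in X$. A function $f$ is odd if $f(-x)=-f(x)$ for all $x$. *)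

theory Defs
  imports Complex_Main
begin

(* The libraries have no notion of semicontinuity for real functions. *)
definition upper_semicontinuous :: "('a::topological_space \<Rightarrow> 'b::order) \<Rightarrow> bool" where
  "upper_semicontinuous g \<longleftrightarrow> (\<forall>t. \<forall>c. g t < c \<longrightarrow> (\<forall>\<^sub>F s in nhds t. g s < c))"

locale fuzzy_normed_space =
  fixes N :: "'v::real_vector \<Rightarrow> real \<Rightarrow> real"
  assumes range_01: "N x a \<in> {0..1}"
    and N1: "a \<le> 0 \<Longrightarrow> N x a = 0"
    and N2: "x = 0 \<longleftrightarrow> (\<forall>a>0. N x a = 1)"
    and N3: "a \<noteq> 0 \<Longrightarrow> N (a *\<^sub>R x) b = N x (b / \<bar>a\<bar>)"
    and N4: "N (x + y) (a + b) \<ge> min (N x a) (N y b)"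
    and N5_mono: "mono (N x)"
    and N5_lim: "(N x \<longlongrightarrow> 1) at_top"
    and N6: "x \<noteq> 0 \<Longrightarrow> upper_semicontinuous (N x)"

definition fuzzy_convergent :: "('v::real_vector \<Rightarrow> real \<Rightarrow> real) \<Rightarrow> (nat \<Rightarrow> 'v) \<Rightarrow> bool" where
  "fuzzy_convergent N u \<longleftrightarrow> (\<exists>x. \<forall>a>0. (\<lambda>n. N (u n - x) a) \<longlonglongrightarrow> 1)"

definition fuzzy_Cauchy :: "('v::real_vector \<Rightarrow> real \<Rightarrow> real) \<Rightarrow> (nat \<Rightarrow> 'v) \<Rightarrow> bool" where
  "fuzzy_Cauchy N u \<longleftrightarrow>
     (\<forall>\<epsilon>>0. \<forall>a>0. \<exists>n0. \<forall>n\<ge>n0. \<forall>p>0. N (u (n + p) - u n) a > 1 - \<epsilon>)"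

locale fuzzy_Banach_space = fuzzy_normed_space +
  assumes complete: "fuzzy_Cauchy N u \<Longrightarrow> fuzzy_convergent N u"

definition N3'' :: "('z \<Rightarrow> real \<Rightarrow> real) \<Rightarrow> ('x::real_vector \<Rightarrow> 'x \<Rightarrow> 'z) \<Rightarrow> 'x \<Rightarrow> real \<Rightarrow> real" where
  "N3'' N' \<phi> x a = Min {N' (\<phi> x x) a,
                        N' (\<phi> (x /\<^sub>R 2) (x /\<^sub>R 2)) a,
                        N' (\<phi> (x /\<^sub>R 2) (2 *\<^sub>R x)) a,
                        N' (\<phi> (x /\<^sub>R 2) ((3/2) *\<^sub>R x)) a}"

end

theory Submission
  imports Defs
begin

text \<open>
  Adding and subtracting the defects of the functional equation at the four pairs
  $(x/2,2x)$, $(x/2,3x/2)$, $(x,x)$ and $(x/2,x/2)$ leaves $2f(2x)-4f(x)$, so $f(2x)/2$ is close to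
  $f(x)$ and Hyers' direct method applies: the sequence $f(2^nx)/2^n$ is Cauchy with geometric rate
  $\alpha/2$. Its limit $A$ is odd and solves the functional equation exactly, hence is additive:
  for the difference $g_x(y)=A(y+x)-A(y)$ the equation reads $g_x(y+3x)+g_x(y)=2A(x)$. Thus $g_x$,
  and so also $g_{2x}$, has period $6x$, while the equation for $2x$ reads
  $g_{2x}(y+6x)+g_{2x}(y)=2A(2x)$; therefore $g_{2x}(y)=A(2x)$.
\<close>

section \<open>Limits in a fuzzy norm\<close>

text \<open>Exposes the limit that \<open>fuzzy_convergent\<close> hides under an existential
  quantifier, so that limits can be added, scaled and compared.\<close>

definition fuzzy_limit :: "('v::real_vector \<Rightarrow> real \<Rightarrow> real) \<Rightarrow> (nat \<Rightarrow> 'v) \<Rightarrow> 'v \<Rightarrow> bool" where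
  "fuzzy_limit N u x \<longleftrightarrow> (\<forall>a>0. (\<lambda>n. N (u n - x) a) \<longlonglongrightarrow> 1)"

context fuzzy_normed_space
begin

lemma le_one: "N x a \<le> 1"
  using range_01[of x a] by simp

lemma mono_arg: "a \<le> b \<Longrightarrow> N x a \<le> N x b"
  using N5_mono by (simp add: monoD)

lemma zero_eq_one: "a > 0 \<Longrightarrow> N 0 a = 1"
  using N2 by blast

lemma minus: "N (- x) a = N x a"
  using N3[of "-1" x a] by simp

lemma diff_commute: "N (x - y) a = N (y - x) a"
  using minus[of "x - y" a] by simp

text \<open>Fuzzy norms never exceed 1, so the upper half of the sandwich is free.\<close>

lemma tendsto_one_lower_bound:
  assumes "l \<longlonglongrightarrow> 1" and "\<And>n. l n \<le> N (u n) (r n)"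
  shows "(\<lambda>n. N (u n) (r n)) \<longlonglongrightarrow> 1"
  by (rule tendsto_sandwich[OF _ _ assms(1) tendsto_const]) (auto simp: assms(2) le_one)

lemma fuzzy_limit_add:
  assumes "fuzzy_limit N u x" "fuzzy_limit N v y"
  shows "fuzzy_limit N (\<lambda>n. u n + v n) (x + y)"
  unfolding fuzzy_limit_def
proof (intro allI impI)
  fix a :: real assume "a > 0"
  then have "(\<lambda>n. min (N (u n - x) (a/2)) (N (v n - y) (a/2))) \<longlonglongrightarrow> min 1 1"
    using assms unfolding fuzzy_limit_def by (intro tendsto_min) auto
  moreover have "min (N (u n - x) (a/2)) (N (v n - y) (a/2)) \<le> N (u n + v n - (x + y)) a" for n
    using N4[of "u n - x" "a/2" "v n - y" "a/2"] by (simp add: algebra_simps)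
  ultimately show "(\<lambda>n. N (u n + v n - (x + y)) a) \<longlonglongrightarrow> 1"
    by (intro tendsto_one_lower_bound) auto
qed

lemma fuzzy_limit_scaleR:
  assumes "fuzzy_limit N u x"
  shows "fuzzy_limit N (\<lambda>n. c *\<^sub>R u n) (c *\<^sub>R x)"
proof (cases "c = 0")
  case True
  then show ?thesis by (simp add: fuzzy_limit_def zero_eq_one)
next
  case False
  then show ?thesis
    using assms by (simp add: fuzzy_limit_def N3 flip: scaleR_diff_right)
qed

lemma fuzzy_limit_minus: "fuzzy_limit N u x \<Longrightarrow> fuzzy_limit N (\<lambda>n. - u n) (- x)"
  using fuzzy_limit_scaleR[of u x "-1"] by simp

lemma fuzzy_limit_diff:
  "fuzzy_limit N u x \<Longrightarrow> fuzzy_limit N v y \<Longrightarrow> fuzzy_limit N (\<lambda>n. u n - v n) (x - y)"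
  using fuzzy_limit_add[OF _ fuzzy_limit_minus] by simp

text \<open>The sequence minus itself is constantly 0 and tends to \<open>x - y\<close>; a constant
  real sequence tending to 1 equals 1, and N2 applies.\<close>

lemma fuzzy_limit_unique:
  assumes "fuzzy_limit N u x" "fuzzy_limit N u y"
  shows "x = y"
proof -
  have "fuzzy_limit N (\<lambda>n. 0) (x - y)"
    using fuzzy_limit_diff[OF assms] by simp
  then have "\<forall>a>0. N (x - y) a = 1"
    unfolding fuzzy_limit_def by (simp add: diff_commute[of y] LIMSEQ_const_iff)
  then show ?thesis using N2[of "x - y"] by simp
qed

end

section \<open>Algebra of the functional equation\<close>

lemma additive_if_odd_solution:
  fixes A :: "'x::real_vector \<Rightarrow> 'y::real_vector"
  assumes odd: "\<And>x. A (- x) = - A x"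
    and double: "\<And>x. A (2 *\<^sub>R x) = 2 *\<^sub>R A x"
    and eq: "\<And>x y. A (2 *\<^sub>R x + y) + A (2 *\<^sub>R x - y) - A (x + y) - A (x - y)
              - 2 *\<^sub>R A (2 *\<^sub>R x) + 2 *\<^sub>R A x = 0"
  shows "Modules.additive A"
proof -
  define g where "g x y = A (y + x) - A y" for x y
  have antiperiod: "g x (y + 3 *\<^sub>R x) + g x y = 2 *\<^sub>R A x" for x y
  proof -
    \<comment> \<open>Replacing \<open>y\<close> by \<open>y + 2 *\<^sub>R x\<close> groups four
      values into two differences of step \<open>x\<close>; doubling turns the other two terms into
      \<open>- 2 *\<^sub>R A x\<close>.\<close>
    have args: "2 *\<^sub>R x + (y + 2 *\<^sub>R x) = (y + 3 *\<^sub>R x) + x" "2 *\<^sub>R x - (y + 2 *\<^sub>R x) = - y"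
      "x + (y + 2 *\<^sub>R x) = y + 3 *\<^sub>R x" "x - (y + 2 *\<^sub>R x) = - (y + x)"
      using scaleR_add_left[of 1 2 x] by (simp_all add: algebra_simps scaleR_2)
    from eq[of x "y + 2 *\<^sub>R x", unfolded args odd double] show ?thesis
      unfolding g_def by (simp add: scaleR_2 algebra_simps)
  qed
  have period: "g x (y + 6 *\<^sub>R x) = g x y" for x y
  proof -
    have "(y + 3 *\<^sub>R x) + 3 *\<^sub>R x = y + 6 *\<^sub>R x"
      using scaleR_add_left[of 3 3 x] by simp
    then show ?thesis
      using antiperiod[of x "y + 3 *\<^sub>R x"] antiperiod[of x y]
      by (metis add.commute add_left_cancel)
  qed
  \<comment> \<open>A translation by \<open>2 *\<^sub>R x\<close> is two translations by
    \<open>x\<close>, so \<open>g (2 *\<^sub>R x)\<close> inherits the period of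
    \<open>g x\<close>.\<close>
  have g_double: "g (2 *\<^sub>R x) y = g x (y + x) + g x y" for x y
    by (simp add: g_def scaleR_2 add.assoc)
  have "g (2 *\<^sub>R x) y = A (2 *\<^sub>R x)" for x y
  proof -
    have "g (2 *\<^sub>R x) (y + 6 *\<^sub>R x) = g (2 *\<^sub>R x) y"
      using period[of x y] period[of x "y + x"] by (simp add: g_double algebra_simps)
    \<comment> \<open>For step \<open>2 *\<^sub>R x\<close> the shift in \<open>antiperiod\<close>
      is exactly this period, so its two summands coincide.\<close>
    then have "2 *\<^sub>R g (2 *\<^sub>R x) y = 2 *\<^sub>R A (2 *\<^sub>R x)"
      using antiperiod[of "2 *\<^sub>R x" y] by (simp flip: scaleR_2)
    then show ?thesis by simp
  qed
  from this[of "x /\<^sub>R 2" for x] have "g x y = A x" for x y by simp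
  then show ?thesis
    unfolding g_def by unfold_locales (metis add.commute diff_add_cancel)
qed

text \<open>The argument is $2u$, so that all multiples of $u$ occurring below are integral.\<close>

lemma odd_defect_combination:
  fixes f :: "'x::real_vector \<Rightarrow> 'y::real_vector" and D :: "'x \<Rightarrow> 'x \<Rightarrow> 'y"
  assumes odd: "\<And>x. f (- x) = - f x"
    and D: "\<And>x y. D x y = f (2 *\<^sub>R x + y) + f (2 *\<^sub>R x - y) - f (x + y) - f (x - y)
              - 2 *\<^sub>R f (2 *\<^sub>R x) + 2 *\<^sub>R f x"
  shows "D u (4 *\<^sub>R u) + D u (3 *\<^sub>R u) - D (2 *\<^sub>R u) (2 *\<^sub>R u) - D u u
          = 2 *\<^sub>R f (4 *\<^sub>R u) - 4 *\<^sub>R f (2 *\<^sub>R u)"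
proof -
  \<comment> \<open>Both diagonal pairs produce a term \<open>f 0\<close>.\<close>
  have f0: "f 0 = 0" using odd[of 0] by (simp add: eq_neg_iff_add_eq_0 flip: scaleR_2)
  have f_diff: "f (a *\<^sub>R u - b *\<^sub>R u) = - f ((b - a) *\<^sub>R u)" for a b
    using odd[of "(b - a) *\<^sub>R u"] by (simp add: algebra_simps)
  have f_sum: "f (a *\<^sub>R u + b *\<^sub>R u) = f ((a + b) *\<^sub>R u)" for a b
    by (simp add: algebra_simps)
  have f1: "f (u + b *\<^sub>R u) = f ((1 + b) *\<^sub>R u)" "f (u - b *\<^sub>R u) = - f ((b - 1) *\<^sub>R u)"
    "f (b *\<^sub>R u + u) = f ((b + 1) *\<^sub>R u)" "f (b *\<^sub>R u - u) = f ((b - 1) *\<^sub>R u)" for b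
    using f_sum[of 1 b] f_diff[of 1 b] f_sum[of b 1] by (simp_all add: algebra_simps)
  have f_self: "f (u + u) = f (2 *\<^sub>R u)" by (simp add: scaleR_2)
  have four: "4 *\<^sub>R v = v + v + v + v" for v :: 'y
    using scaleR_add_left[of 2 2 v] by (simp add: scaleR_2)
  \<comment> \<open>The values at \<open>u\<close> and at its multiples by 3, 5 and 6 cancel; those
    at the multiples by 2 and 4 remain.\<close>
  show ?thesis
    unfolding D by (simp add: f_diff f_sum f1 f_self f0 odd scaleR_2[where 'a='y] four)
qed

section \<open>The direct method and uniqueness\<close>

lemma iterate_doubling:
  fixes M :: "'x::real_vector \<Rightarrow> real \<Rightarrow> real"
  assumes "0 < \<alpha>" and double: "\<And>x a. a > 0 \<Longrightarrow> M x a \<le> M (2 *\<^sub>R x) (\<alpha> * a)" and "a > 0"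
  shows "M x a \<le> M (2 ^ n *\<^sub>R x) (\<alpha> ^ n * a)"
proof (induction n)
  case (Suc n)
  also have "M (2 ^ n *\<^sub>R x) (\<alpha> ^ n * a) \<le> M (2 ^ Suc n *\<^sub>R x) (\<alpha> ^ Suc n * a)"
    using double[of "\<alpha> ^ n * a" "2 ^ n *\<^sub>R x"] assms(1,3) by (simp add: mult.assoc)
  finally show ?case .
qed simp

text \<open>Hyers' direct method with a control function $M$ in place of the fuzzy norm of an error term.\<close>

lemma (in fuzzy_Banach_space) direct_method:
  fixes f :: "'x::real_vector \<Rightarrow> 'a" and M :: "'x \<Rightarrow> real \<Rightarrow> real"
  assumes \<alpha>: "0 < \<alpha>" "\<alpha> < 2"
    and M_lim: "\<And>x. (M x \<longlongrightarrow> 1) at_top"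
    and M_double: "\<And>x a. a > 0 \<Longrightarrow> M x a \<le> M (2 *\<^sub>R x) (\<alpha> * a)"
    and close: "\<And>x a. a > 0 \<Longrightarrow> M x a \<le> N (f (2 *\<^sub>R x) /\<^sub>R 2 - f x) a"
  obtains A where "\<And>x. fuzzy_limit N (\<lambda>n. f (2 ^ n *\<^sub>R x) /\<^sub>R 2 ^ n) (A x)"
    and "\<And>x a. a > 0 \<Longrightarrow> M x (a * (2 - \<alpha>) / 4) \<le> N (A x - f x) a"
proof -
  define u where "u x n = f (2 ^ n *\<^sub>R x) /\<^sub>R 2 ^ n" for x n
  have M_pow: "M x a \<le> M (2 ^ n *\<^sub>R x) (\<alpha> ^ n * a)" if "a > 0" for x a n
    using iterate_doubling[of \<alpha> M] \<alpha>(1) M_double that by blast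
  \<comment> \<open>Moving to \<open>2 ^ n *\<^sub>R x\<close> costs a factor
    \<open>\<alpha> ^ n\<close> in the parameter, and dividing the values by \<open>2 ^ n\<close>
    gains \<open>2 ^ n\<close> back by N3.\<close>
  have step: "M x t \<le> N (u x (Suc n) - u x n) (t * (\<alpha> / 2) ^ n)" if "t > 0" for x t n
  proof -
    have "M x t \<le> N (f (2 ^ Suc n *\<^sub>R x) /\<^sub>R 2 - f (2 ^ n *\<^sub>R x)) (\<alpha> ^ n * t)"
      using M_pow[OF that, of x n] close[of "\<alpha> ^ n * t" "2 ^ n *\<^sub>R x"] \<alpha> that by simp
    also have "\<dots> = N (inverse (2 ^ n) *\<^sub>R (f (2 ^ Suc n *\<^sub>R x) /\<^sub>R 2 - f (2 ^ n *\<^sub>R x)))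
                     (t * (\<alpha> / 2) ^ n)"
      by (subst N3) (simp_all add: field_simps)
    also have "inverse (2 ^ n) *\<^sub>R (f (2 ^ Suc n *\<^sub>R x) /\<^sub>R 2 - f (2 ^ n *\<^sub>R x)) = u x (Suc n) - u x n"
      by (simp add: u_def scaleR_diff_right mult.commute)
    finally show ?thesis .
  qed
  \<comment> \<open>All steps share the lower bound \<open>M x t\<close>, so the minimum in N4 loses
    nothing. The count starts at \<open>Suc p\<close>: over zero steps the sum is empty, and N1
    makes the right side 0.\<close>
  have tele: "M x t \<le> N (u x (n + Suc p) - u x n) (\<Sum>k=n..n+p. t * (\<alpha> / 2) ^ k)"
    if "t > 0" for x t n p
  proof (induction p)
    case 0
    then show ?case using step[OF that] by simp
  next
    case (Suc p)
    with step[OF that, of x "n + Suc p"] show ?case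
      using N4[of "u x (n + Suc p) - u x n" "\<Sum>k=n..n+p. t * (\<alpha> / 2) ^ k"
          "u x (Suc (n + Suc p)) - u x (n + Suc p)" "t * (\<alpha> / 2) ^ (n + Suc p)"]
      by (simp add: algebra_simps)
  qed
  \<comment> \<open>The constant \<open>2 / (2 - \<alpha>)\<close> is the sum of the full geometric
    series with ratio \<open>\<alpha> / 2\<close>.\<close>
  have geometric: "(\<Sum>k=n..n+p. t * (\<alpha> / 2) ^ k) \<le> t * (\<alpha> / 2) ^ n * (2 / (2 - \<alpha>))"
    if "t > 0" for t n p
  proof -
    have "(\<Sum>k=n..n+p. t * (\<alpha> / 2) ^ k) = t * ((\<Sum>k=n..n+p. (\<alpha> / 2) ^ k))"
      by (simp add: sum_distrib_left)
    also have "(\<Sum>k=n..n+p. (\<alpha> / 2) ^ k) = (\<alpha> / 2) ^ n * (1 - (\<alpha> / 2) ^ Suc p) / (1 - \<alpha> / 2)"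
      using \<alpha> by (subst sum_gp_offset) auto
    also have "\<dots> \<le> (\<alpha> / 2) ^ n * 1 / (1 - \<alpha> / 2)"
      using \<alpha> by (intro divide_right_mono mult_left_mono) auto
    also have "\<dots> = (\<alpha> / 2) ^ n * (2 / (2 - \<alpha>))" using \<alpha> by (simp add: field_simps)
    finally show ?thesis using that by (simp add: mult.assoc)
  qed
  have bound: "M x t \<le> N (u x (n + p) - u x n) (t * (\<alpha> / 2) ^ n * (2 / (2 - \<alpha>)))"
    if "t > 0" "p > 0" for x t n p
    using tele[OF that(1), of x n "p - 1"] mono_arg[OF geometric[OF that(1), of n "p - 1"]] that(2)
    by (fastforce intro: order_trans)
  have "fuzzy_Cauchy N (u x)" for x
    unfolding fuzzy_Cauchy_def
  proof (intro allI impI)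
    fix \<epsilon> a :: real assume "\<epsilon> > 0" "a > 0"
    \<comment> \<open>First \<open>t\<close> is fixed so large that \<open>M x t\<close> exceeds
      \<open>1 - \<epsilon>\<close>; only then is \<open>n\<close> taken large enough to push the
      parameter below \<open>a\<close>.\<close>
    have "\<forall>\<^sub>F t in at_top. M x t > 1 - \<epsilon> \<and> t > 0"
      using order_tendstoD(1)[OF M_lim, of "1 - \<epsilon>" x] \<open>\<epsilon> > 0\<close> eventually_gt_at_top[of 0]
      by (simp add: eventually_conj)
    then obtain t where t: "M x t > 1 - \<epsilon>" "t > 0"
      by (metis (mono_tags, lifting) eventually_happens trivial_limit_at_top_linorder)
    have "(\<lambda>n. t * (\<alpha> / 2) ^ n * (2 / (2 - \<alpha>))) \<longlonglongrightarrow> t * 0 * (2 / (2 - \<alpha>))"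
      using \<alpha> by (intro tendsto_intros LIMSEQ_power_zero) auto
    then have "\<forall>\<^sub>F n in sequentially. t * (\<alpha> / 2) ^ n * (2 / (2 - \<alpha>)) < a"
      using \<open>a > 0\<close> by (intro order_tendstoD(2)) auto
    then obtain n0 where n0: "\<And>n. n \<ge> n0 \<Longrightarrow> t * (\<alpha> / 2) ^ n * (2 / (2 - \<alpha>)) < a"
      unfolding eventually_sequentially by blast
    show "\<exists>n0. \<forall>n\<ge>n0. \<forall>p>0. N (u x (n + p) - u x n) a > 1 - \<epsilon>"
    proof (intro exI[of _ n0] allI impI)
      fix n p :: nat assume "n \<ge> n0" "p > 0"
      then show "N (u x (n + p) - u x n) a > 1 - \<epsilon>"
        using t(1) bound[OF t(2), of p x n] mono_arg[OF less_imp_le[OF n0[of n]], of "u x (n + p) - u x n"]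
        by linarith
    qed
  qed
  then have "\<exists>y. fuzzy_limit N (u x) y" for x
    using complete unfolding fuzzy_convergent_def fuzzy_limit_def by blast
  then obtain A where A: "\<And>x. fuzzy_limit N (u x) (A x)" by metis
  have "M x (a * (2 - \<alpha>) / 4) \<le> N (A x - f x) a" if "a > 0" for x a
  proof (rule LIMSEQ_le_const2)
    let ?m = "M x (a * (2 - \<alpha>) / 4)"
    have u0: "u x 0 = f x" by (simp add: u_def)
    \<comment> \<open>This is \<open>bound\<close> from index 0. The choice
      \<open>t = a * (2 - \<alpha>) / 4\<close> makes the series total \<open>a / 2\<close>, leaving
      the other half of \<open>a\<close> for the passage from \<open>u x n\<close> to the
      limit.\<close>
    have close_n: "?m \<le> N (u x n - f x) (a / 2)" if "n > 0" for n
    proof -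
      have "a * (2 - \<alpha>) / 4 * (\<alpha> / 2) ^ 0 * (2 / (2 - \<alpha>)) = a / 2"
        using \<alpha> by (simp add: divide_simps)
      then show ?thesis
        using bound[of "a * (2 - \<alpha>) / 4" n x 0] \<open>a > 0\<close> \<alpha> that by (simp only: u0) simp
    qed
    have "min (N (u x n - A x) (a / 2)) ?m \<le> N (A x - f x) a" if "n > 0" for n
    proof -
      have "min (N (u x n - A x) (a / 2)) ?m \<le> min (N (u x n - A x) (a / 2)) (N (u x n - f x) (a / 2))"
        by (intro min.mono order_refl close_n that)
      also have "\<dots> \<le> N (A x - f x) a"
        using N4[of "A x - u x n" "a / 2" "u x n - f x" "a / 2"] diff_commute[of "A x"] by simp
      finally show ?thesis .
    qed
    then show "\<exists>n0. \<forall>n\<ge>n0. min (N (u x n - A x) (a / 2)) ?m \<le> N (A x - f x) a"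
      by (intro exI[of _ 1]) simp
    \<comment> \<open>No upper bound on \<open>M\<close> is assumed; this one makes
      \<open>min 1 ?m\<close>, the limit of the minima, equal to \<open>?m\<close>.\<close>
    have "?m \<le> 1"
      by (rule order_trans[OF close_n[of 1] le_one]) simp
    then show "(\<lambda>n. min (N (u x n - A x) (a / 2)) ?m) \<longlonglongrightarrow> ?m"
      using tendsto_min[OF _ tendsto_const, of "\<lambda>n. N (u x n - A x) (a / 2)" 1 sequentially ?m]
        A[of x] \<open>a > 0\<close> by (simp add: fuzzy_limit_def min_absorb2)
  qed
  with that A show thesis unfolding u_def by blast
qed

text \<open>Both maps are compared with \<open>f\<close> at \<open>2 ^ n *\<^sub>R x\<close>. By
  additivity their difference there is \<open>2 ^ n\<close> times that at \<open>x\<close>, which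
  outgrows the loss \<open>\<alpha> ^ n\<close> since \<open>\<alpha> < 2\<close>.\<close>

lemma (in fuzzy_normed_space) additive_approximation_unique:
  fixes f :: "'x::real_vector \<Rightarrow> 'v" and M :: "'x \<Rightarrow> real \<Rightarrow> real"
  assumes \<alpha>: "0 < \<alpha>" "\<alpha> < 2" and "c > 0"
    and M_lim: "\<And>x. (M x \<longlongrightarrow> 1) at_top"
    and M_double: "\<And>x a. a > 0 \<Longrightarrow> M x a \<le> M (2 *\<^sub>R x) (\<alpha> * a)"
    and A: "Modules.additive A" "\<And>x a. a > 0 \<Longrightarrow> M x (c * a) \<le> N (A x - f x) a"
    and B: "Modules.additive B" "\<And>x a. a > 0 \<Longrightarrow> M x (c * a) \<le> N (B x - f x) a"
  shows "A = B"
proof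
  fix x
  have pow: "h (2 ^ n *\<^sub>R x) = 2 ^ n *\<^sub>R h x" if "Modules.additive h" for h :: "'x \<Rightarrow> 'v" and n
    by (induction n) (simp_all add: additive.add[OF that] scaleR_2 flip: scaleR_scaleR)
  have M_pow: "M x a \<le> M (2 ^ n *\<^sub>R x) (\<alpha> ^ n * a)" if "a > 0" for x a n
    using iterate_doubling[of \<alpha> M] \<alpha>(1) M_double that by blast
  have "N (A x - B x) a = 1" if "a > 0" for a
  proof (rule antisym[OF le_one])
    \<comment> \<open>Chosen so that \<open>\<alpha> ^ n * r n\<close> is \<open>c\<close> times
      half of \<open>2 ^ n * a\<close>, one half for each of \<open>A\<close> and
      \<open>B\<close>.\<close>
    define r where "r n = c * a / 2 * (2 / \<alpha>) ^ n" for n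
    have "M x (r n) \<le> N (A x - B x) a" for n
    proof -
      let ?y = "2 ^ n *\<^sub>R x"
      have "M x (r n) \<le> M ?y (c * (2 ^ n * a / 2))"
        using M_pow[of "r n" x n] \<alpha> \<open>c > 0\<close> \<open>a > 0\<close> by (simp add: r_def field_simps)
      then have "M x (r n) \<le> min (N (A ?y - f ?y) (2 ^ n * a / 2)) (N (f ?y - B ?y) (2 ^ n * a / 2))"
        using A(2)[of "2 ^ n * a / 2" ?y] B(2)[of "2 ^ n * a / 2" ?y] \<open>a > 0\<close>
        by (simp add: diff_commute[of "f ?y"])
      also have "\<dots> \<le> N (A ?y - B ?y) (2 ^ n * a)"
        using N4[of "A ?y - f ?y" "2 ^ n * a / 2" "f ?y - B ?y" "2 ^ n * a / 2"]
        by (simp add: mult.commute)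
      also have "\<dots> = N (A x - B x) a"
        using N3[of "2 ^ n" "A x - B x"] by (simp add: pow A(1) B(1) scaleR_diff_right)
      finally show ?thesis .
    qed
    moreover have "filterlim r at_top sequentially"
      unfolding r_def using \<alpha> \<open>c > 0\<close> \<open>a > 0\<close>
      by (intro filterlim_tendsto_pos_mult_at_top[OF tendsto_const]
            filterlim_at_infinity_imp_filterlim_at_top[OF filterlim_realpow_sequentially_gt1]) auto
    then have "(\<lambda>n. M x (r n)) \<longlonglongrightarrow> 1"
      by (rule filterlim_compose[OF M_lim])
    ultimately show "1 \<le> N (A x - B x) a"
      by (intro LIMSEQ_le_const2) auto
  qed
  then show "A x = B x" using N2[of "A x - B x"] by simp
qed

section \<open>The control function \<open>N3''\<close> and the theorem\<close>

lemma N3''_eq_min: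
  "N3'' N' \<phi> x a = min (min (N' (\<phi> x x) a) (N' (\<phi> (x /\<^sub>R 2) (x /\<^sub>R 2)) a))
     (min (N' (\<phi> (x /\<^sub>R 2) (2 *\<^sub>R x)) a) (N' (\<phi> (x /\<^sub>R 2) ((3/2) *\<^sub>R x)) a))"
  by (simp add: N3''_def min.assoc)

theorem theorem2p3:
  fixes N :: "'y::real_vector \<Rightarrow> real \<Rightarrow> real"
    and N' :: "'z::real_vector \<Rightarrow> real \<Rightarrow> real"
    and \<phi>\<^sub>3 :: "'x::real_vector \<Rightarrow> 'x \<Rightarrow> 'z"
    and f :: "'x \<Rightarrow> 'y"
    and \<alpha> :: real
  assumes "fuzzy_Banach_space N"
    and "fuzzy_normed_space N'"
    and "0 < \<alpha>" and "\<alpha> < 2"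
    and "\<And>x y a. y \<in> {x, x /\<^sub>R 2, (3/2) *\<^sub>R x, 2 *\<^sub>R x} \<Longrightarrow> a > 0 \<Longrightarrow>
           N' (\<phi>\<^sub>3 (2 *\<^sub>R (x /\<^sub>R 2)) (2 *\<^sub>R y)) a \<ge> N' (\<alpha> *\<^sub>R \<phi>\<^sub>3 (x /\<^sub>R 2) y) a"
    and "\<And>x y a. a > 0 \<Longrightarrow>
           (\<lambda>n. N' (\<phi>\<^sub>3 (2 ^ n *\<^sub>R x) (2 ^ n *\<^sub>R y)) (2 ^ n * a)) \<longlonglongrightarrow> 1"
    and "\<And>x. f (- x) = - f x"
    and "\<And>x y a. a > 0 \<Longrightarrow>
           N (f (2 *\<^sub>R x + y) + f (2 *\<^sub>R x - y) - f (x + y) - f (x - y)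
              - 2 *\<^sub>R f (2 *\<^sub>R x) + 2 *\<^sub>R f x) a \<ge> N' (\<phi>\<^sub>3 x y) a"
  shows "\<exists>!A :: 'x \<Rightarrow> 'y. Modules.additive A \<and>
           (\<forall>x. \<forall>a>0. N (A x - f x) a \<ge> N3'' N' \<phi>\<^sub>3 x (a * (2 - \<alpha>) / 4))"
proof -
  interpret N: fuzzy_Banach_space N by fact
  interpret N': fuzzy_normed_space N' by fact
  note \<alpha> = assms(3,4) and odd = assms(7)
  let ?M = "N3'' N' \<phi>\<^sub>3"
  define D where "D x y = f (2 *\<^sub>R x + y) + f (2 *\<^sub>R x - y) - f (x + y) - f (x - y)
              - 2 *\<^sub>R f (2 *\<^sub>R x) + 2 *\<^sub>R f x" for x y
  have D_bound: "N' (\<phi>\<^sub>3 x y) a \<le> N (D x y) a" if "a > 0" for x y a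
    using assms(8)[OF that] by (simp add: D_def)
  have M_lim: "(?M x \<longlongrightarrow> 1) at_top" for x
  proof -
    have "(?M x \<longlongrightarrow> min (min 1 1) (min 1 1)) at_top"
      unfolding N3''_eq_min by (intro tendsto_min N'.N5_lim)
    then show ?thesis by simp
  qed
  \<comment> \<open>The hypothesis is read at parameter \<open>\<alpha> * a\<close>, where N3
    cancels the factor \<open>\<alpha>\<close>.\<close>
  have \<phi>_double: "N' (\<phi>\<^sub>3 (x /\<^sub>R 2) y) a \<le> N' (\<phi>\<^sub>3 x (2 *\<^sub>R y)) (\<alpha> * a)"
    if "y \<in> {x, x /\<^sub>R 2, (3/2) *\<^sub>R x, 2 *\<^sub>R x}" "a > 0" for x y a
    using assms(5)[OF that(1), of "\<alpha> * a"] N'.N3[of \<alpha> "\<phi>\<^sub>3 (x /\<^sub>R 2) y" "\<alpha> * a"] \<alpha> that(2) by simp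
  have M_double: "?M x a \<le> ?M (2 *\<^sub>R x) (\<alpha> * a)" if "a > 0" for x a
    \<comment> \<open>Entry by entry: \<open>\<phi>\<^sub>3\<close> at \<open>(2x, 2x)\<close> is
      bounded via the point \<open>2x\<close> and its half, the other three entries via the point
      \<open>x\<close>.\<close>
    using \<phi>_double[of "x /\<^sub>R 2" x a] \<phi>_double[of "2 *\<^sub>R x" x a]
      \<phi>_double[of "(3/2) *\<^sub>R x" x a] \<phi>_double[of x "2 *\<^sub>R x" a] that
    by (simp add: N3''_eq_min min_le_iff_disj)
  have close: "?M x a \<le> N (f (2 *\<^sub>R x) /\<^sub>R 2 - f x) a" if "a > 0" for x a
  proof -
    let ?u = "x /\<^sub>R 2"
    let ?D = "D ?u (2 *\<^sub>R x) + D ?u ((3/2) *\<^sub>R x) - D x x - D ?u ?u"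
    have "?D = 2 *\<^sub>R f (2 *\<^sub>R x) - 4 *\<^sub>R f x"
      using odd_defect_combination[of f D, OF odd D_def, of ?u] by simp
    then have "N (f (2 *\<^sub>R x) /\<^sub>R 2 - f x) a = N ((1/4) *\<^sub>R ?D) a"
      by (simp add: scaleR_diff_right)
    \<comment> \<open>N3 turns the factor 1/4 into the parameter \<open>4 * a\<close>, bracketed so
      that three uses of N4 give each defect the share \<open>a\<close>.\<close>
    also have "\<dots> = N ?D ((a + a) + a + a)"
      by (subst N.N3) (simp_all add: mult.commute)
    also have "\<dots> \<ge> ?M x a"
      using N.N4[of "D ?u (2 *\<^sub>R x)" a "D ?u ((3/2) *\<^sub>R x)" a]
        N.N4[of "D ?u (2 *\<^sub>R x) + D ?u ((3/2) *\<^sub>R x)" "a + a" "- D x x" a]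
        N.N4[of "D ?u (2 *\<^sub>R x) + D ?u ((3/2) *\<^sub>R x) - D x x" "a + a + a" "- D ?u ?u" a]
        D_bound[OF that, of ?u "2 *\<^sub>R x"] D_bound[OF that, of ?u "(3/2) *\<^sub>R x"]
        D_bound[OF that, of x x] D_bound[OF that, of ?u ?u]
      unfolding N3''_eq_min N.minus diff_conv_add_uminus by linarith
    finally show ?thesis .
  qed
  obtain A where A_lim: "\<And>x. fuzzy_limit N (\<lambda>n. f (2 ^ n *\<^sub>R x) /\<^sub>R 2 ^ n) (A x)"
    and A_close: "\<And>x a. a > 0 \<Longrightarrow> ?M x (a * (2 - \<alpha>) / 4) \<le> N (A x - f x) a"
    by (rule N.direct_method[of \<alpha> ?M f]) (use \<alpha> M_lim M_double close in auto)
  have A_odd: "A (- x) = - A x" for x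
    using N.fuzzy_limit_unique[OF A_lim[of "- x"]] N.fuzzy_limit_minus[OF A_lim[of x]]
    by (simp add: odd)
  have A_eq: "A (2 *\<^sub>R x + y) + A (2 *\<^sub>R x - y) - A (x + y) - A (x - y)
              - 2 *\<^sub>R A (2 *\<^sub>R x) + 2 *\<^sub>R A x = 0" for x y
  proof -
    let ?L = "A (2 *\<^sub>R x + y) + A (2 *\<^sub>R x - y) - A (x + y) - A (x - y)
              - 2 *\<^sub>R A (2 *\<^sub>R x) + 2 *\<^sub>R A x"
    let ?u = "\<lambda>x n. f (2 ^ n *\<^sub>R x) /\<^sub>R 2 ^ n"
    \<comment> \<open>The rescaled defects of \<open>f\<close> tend to the defect \<open>?L\<close>
      of \<open>A\<close> by linearity, and to 0 by the limit hypothesis on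
      \<open>\<phi>\<^sub>3\<close>; limits are unique.\<close>
    let ?v = "\<lambda>n. D (2 ^ n *\<^sub>R x) (2 ^ n *\<^sub>R y) /\<^sub>R 2 ^ n"
    have "?v n = ?u (2 *\<^sub>R x + y) n + ?u (2 *\<^sub>R x - y) n - ?u (x + y) n - ?u (x - y) n
              - 2 *\<^sub>R ?u (2 *\<^sub>R x) n + 2 *\<^sub>R ?u x n" for n
      by (simp add: D_def scaleR_diff_right scaleR_add_right mult.commute)
    moreover have "fuzzy_limit N (\<lambda>n. ?u (2 *\<^sub>R x + y) n + ?u (2 *\<^sub>R x - y) n - ?u (x + y) n
        - ?u (x - y) n - 2 *\<^sub>R ?u (2 *\<^sub>R x) n + 2 *\<^sub>R ?u x n) ?L"
      by (intro N.fuzzy_limit_add N.fuzzy_limit_diff N.fuzzy_limit_scaleR A_lim)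
    ultimately have "fuzzy_limit N ?v ?L" by simp
    moreover have "fuzzy_limit N ?v 0"
      unfolding fuzzy_limit_def
    proof (intro allI impI)
      fix a :: real assume "a > 0"
      have "N' (\<phi>\<^sub>3 (2 ^ n *\<^sub>R x) (2 ^ n *\<^sub>R y)) (2 ^ n * a) \<le> N (?v n - 0) a" for n
        using D_bound[of "2 ^ n * a"] \<open>a > 0\<close> by (simp add: N.N3 field_simps)
      then show "(\<lambda>n. N (?v n - 0) a) \<longlonglongrightarrow> 1"
        by (rule N.tendsto_one_lower_bound[OF assms(6)[OF \<open>a > 0\<close>]])
    qed
    ultimately show ?thesis by (rule N.fuzzy_limit_unique)
  qed
  have A_double: "A (2 *\<^sub>R x) = 2 *\<^sub>R A x" for x
  proof -
    \<comment> \<open>\<open>A\<close> has defect zero, so the combination identity for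
      \<open>f\<close> applies to it with \<open>D\<close> identically 0.\<close>
    have "2 *\<^sub>R A (2 *\<^sub>R x) = 4 *\<^sub>R A x"
      using odd_defect_combination[of A "\<lambda>x y. 0", OF A_odd A_eq[symmetric], of "x /\<^sub>R 2"] by simp
    then have "(2 *\<^sub>R A (2 *\<^sub>R x)) /\<^sub>R 2 = (4 *\<^sub>R A x) /\<^sub>R 2"
      by (rule arg_cong)
    then show ?thesis by simp
  qed
  have A_add: "Modules.additive A"
    by (rule additive_if_odd_solution[OF A_odd A_double A_eq])
  show ?thesis
  proof (intro ex1I[of _ A] conjI A_add allI impI A_close)
    fix B assume B: "Modules.additive B \<and>
      (\<forall>x. \<forall>a>0. N (B x - f x) a \<ge> ?M x (a * (2 - \<alpha>) / 4))"
    show "B = A"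
      by (rule N.additive_approximation_unique[of \<alpha> "(2 - \<alpha>) / 4" ?M B f A])
        (use \<alpha> B A_add A_close M_lim M_double in \<open>simp_all add: mult.commute\<close>)
  qed
qed

end
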